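(* Let $m \equiv 0 \pmod{4}$ be a positive integer, and let $e$ be an integer with $2 \leq e \leq \lfloor m/2\rfloor$ and $\gcd(m,e)=2$. Let $\alpha$ be a generator of $\mathbb{F}_{2^m}^*$, let $\mathcal{C}_E$ be the binary cyclic code of length $2^m-1$ with generator polynomial $\operatorname{lcm}\big(\mathbb{M}_{\alpha}(x),\mathbb{M}_{\alpha^{1+2^e}}(x)\big)$, and let $\overline{\mathcal{C}_E}$ be its extended code, with coordinates indexed by $V=\{0,1,\dots,2^m-1\}$. Then the supports of the codewords of Hamming weight $6$ in $\overline{\mathcal{C}_E}$ form a $2$-$(2^m,6,\lambda)$ design on $V$ with $$\lambda=\frac{2^{2m-3}+2^m+12}{3}.$$
   Context: $\mathbb{M}_{\beta}(x)$ denotes the minimal polynomial of $\beta\in\mathbb{F}_{2^m}$ over $\mathbb{F}_2$. A binary cyclic code of length $n$ with generator polynomial $g(x)$ is the ideal generated by $g(x)$ in $\mathbb{F}_2[x]/(x^n-1)$, identified with vectors in $\mathbb{F}_2^n$. The extended code is obtained by appending an overall parity-check coordinate (sum of all coordinates) to each codeword. The support of a codeword is the set of coordinates where it is nonzero. A $2$-$(v,k,\lambda)$ design is a pair $(V,\mathcal{B})$ with $|V|=v$ and $\mathcal{B}$ a set of $k$-subsets of $V$ such that every $2$-subset of $V$ is contained in exactly $\lambda$ members of $\mathcal{B}$. *)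

theory Defs
  imports
    Complex_Main
    "HOL-Library.Cardinality"
    "HOL-Library.Z2"
    "HOL-Computational_Algebra.Computational_Algebra"
    "HOL-Computational_Algebra.Field_as_Ring"
begin

text \<open>
  The field of two elements is the type \<open>bit\<close>. The instances below follow the library's
  treatment of \<open>real\<close> and \<open>rat\<close> as trivial Euclidean rings; they make the library's
  \<open>lcm\<close> available on \<open>bit poly\<close>, normalized to be monic.
\<close>

instantiation bit ::
  "{unique_euclidean_ring, normalization_euclidean_semiring, normalization_semidom_multiplicative}"
begin

definition [simp]: "normalize_bit = (normalize_field :: bit \<Rightarrow> _)"
definition [simp]: "unit_factor_bit = (unit_factor_field :: bit \<Rightarrow> _)"
definition [simp]: "euclidean_size_bit = (euclidean_size_field :: bit \<Rightarrow> _)"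
definition [simp]: "division_segment (x :: bit) = 1"

instance
  by standard
    (auto simp add: dvd_field_iff field_split_simps modulo_bit_def split: if_splits)

end

instantiation bit :: euclidean_ring_gcd
begin

definition gcd_bit :: "bit \<Rightarrow> bit \<Rightarrow> bit" where
  "gcd_bit = Euclidean_Algorithm.gcd"
definition lcm_bit :: "bit \<Rightarrow> bit \<Rightarrow> bit" where
  "lcm_bit = Euclidean_Algorithm.lcm"
definition Gcd_bit :: "bit set \<Rightarrow> bit" where
  "Gcd_bit = Euclidean_Algorithm.Gcd"
definition Lcm_bit :: "bit set \<Rightarrow> bit" where
  "Lcm_bit = Euclidean_Algorithm.Lcm"

instance by standard (simp_all add: gcd_bit_def lcm_bit_def Gcd_bit_def Lcm_bit_def)

end

instance bit :: field_gcd ..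

text \<open>
  Evaluation goes through \<open>of_bit\<close>, which is a ring homomorphism exactly when the
  field \<open>'a\<close> has characteristic 2.
\<close>

definition is_root_F2 :: "bit poly \<Rightarrow> 'a::field \<Rightarrow> bool" where
  "is_root_F2 p \<beta> \<longleftrightarrow> poly (map_poly of_bit p) \<beta> = 0"

definition min_poly :: "'a::field \<Rightarrow> bit poly" where
  "min_poly \<beta> = (THE p. lead_coeff p = 1 \<and> is_root_F2 p \<beta> \<and>
     (\<forall>q. q \<noteq> 0 \<and> is_root_F2 q \<beta> \<longrightarrow> degree p \<le> degree q))"

definition generates_units :: "'a::field \<Rightarrow> bool" where
  "generates_units \<alpha> \<longleftrightarrow> range (\<lambda>k::nat. \<alpha> ^ k) = UNIV - {0}"

text \<open>
  A vector \<open>c\<close> of length \<open>n\<close> stands for the residue class of the polynomial with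
  coefficient list \<open>c\<close> modulo \<open>x\<^sup>n - 1\<close>; it is a codeword iff this class is a multiple
  of the class of \<open>g\<close>.
\<close>

definition cyclic_code :: "nat \<Rightarrow> bit poly \<Rightarrow> bit list set" where
  "cyclic_code n g = {c. length c = n \<and> (\<exists>a. (monom 1 n - 1) dvd (Poly c - a * g))}"

definition extended_code :: "bit list set \<Rightarrow> bit list set" where
  "extended_code C = (\<lambda>c. c @ [sum_list c]) ` C"

definition support :: "bit list \<Rightarrow> nat set" where
  "support c = {i. i < length c \<and> c ! i \<noteq> 0}"

definition hamming_weight :: "bit list \<Rightarrow> nat" where
  "hamming_weight c = card (support c)"

definition is_2_design :: "nat \<Rightarrow> nat \<Rightarrow> nat \<Rightarrow> 'v set \<Rightarrow> 'v set set \<Rightarrow> bool" where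
  "is_2_design v k l V \<B> \<longleftrightarrow>
     finite V \<and> card V = v \<and>
     (\<forall>B\<in>\<B>. B \<subseteq> V \<and> card B = k) \<and>
     (\<forall>T. T \<subseteq> V \<and> card T = 2 \<longrightarrow> card {B \<in> \<B>. T \<subseteq> B} = l)"

end

theory Submission
  imports Defs "HOL-Combinatorics.Multiset_Permutations"
begin

text \<open>
  Index the coordinates by the field of order \<open>q = 2^m\<close>: position \<open>i < q - 1\<close> by \<open>\<alpha>^i\<close>, the parity
  position by 0. With \<open>s(x) = x^(2^e)\<close>, the blocks become the 6-subsets \<open>A\<close> of the field with
  \<open>\<Sum>x\<in>A. x = 0\<close> and \<open>\<Sum>x\<in>A. x s(x) = 0\<close>. This family is invariant under the affine group,
  which is doubly transitive, so it suffices to count the blocks through 0 and 1, that is, the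
  quadruples \<open>(a,b,c,d)\<close> completing 0, 1 to a block. Without the distinctness condition, a change
  of variables turns the two equations into \<open>x (s(s(r)) + r) = s(u) + u\<close>, which has
  \<open>q^2 + 48q\<close> solutions since \<open>s\<close> fixes 4 and \<open>s \<circ> s\<close> fixes 16 elements. The degenerate
  quadruples contain a repeated entry (\<open>24q - 32\<close> of them) or an entry 0 or 1 together with an
  affine line over the field of order 4 (\<open>8q - 32\<close> each), leaving \<open>q^2 + 8q + 96 = 24\<lambda>\<close>.
\<close>

section \<open>Finite fields of characteristic two\<close>

text \<open>Multiplication by \<open>x\<close> permutes the units, so their product is unchanged by
  the factor \<open>x ^ (CARD('a) - 1)\<close>.\<close>

lemma finite_field_power_card_minus_one:
  fixes x :: "'a::{field,finite}"
  assumes "x \<noteq> 0"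
  shows "x ^ (CARD('a) - 1) = 1"
proof -
  let ?U = "UNIV - {0::'a}"
  have "bij_betw ((*) x) ?U ?U"
    by (rule bij_betwI[where g = "\<lambda>y. y / x"]) (use assms in auto)
  then have "\<Prod>?U = (\<Prod>y\<in>?U. x * y)"
    using prod.reindex_bij_betw[of "(*) x" ?U ?U "\<lambda>y. y"] by simp
  also have "\<dots> = x ^ card ?U * \<Prod>?U"
    by (simp add: prod.distrib)
  finally have "x ^ card ?U * \<Prod>?U = 1 * \<Prod>?U"
    by simp
  moreover have "\<Prod>?U \<noteq> 0"
    by simp
  ultimately have "x ^ card ?U = 1"
    by (metis mult_right_cancel)
  then show ?thesis
    by (simp add: card_Diff_singleton)
qed

lemma power_power_fixed:
  fixes x :: "'a::monoid_mult"
  assumes "x ^ (b ^ d) = x"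
  shows "x ^ (b ^ (d * k)) = x"
proof (induction k)
  case (Suc k)
  have "x ^ (b ^ (d * Suc k)) = (x ^ (b ^ d)) ^ (b ^ (d * k))"
    by (simp only: mult_Suc_right power_add power_mult[of x])
  then show ?case
    by (simp only: assms Suc)
qed simp

lemma minus_one_dvd_power_minus_one: "b - 1 dvd b ^ k - 1" if "b > 0" for b :: nat
proof (induction k)
  case (Suc k)
  have "b ^ Suc k - 1 = b ^ k * (b - 1) + (b ^ k - 1)"
    using that by (simp add: algebra_simps)
  then show ?case
    using Suc by simp
qed simp

locale binary_field =
  fixes m :: nat and \<alpha> :: "'a::{field,finite}"
  assumes m_pos: "m > 0"
    and card_field: "CARD('a) = 2 ^ m"
    and generator: "generates_units \<alpha>"
begin

definition N :: nat where "N = 2 ^ m - 1"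

lemma Suc_N: "Suc N = 2 ^ m"
  by (simp add: N_def)

lemma N_pos: "N > 0"
  using m_pos one_less_power[of "2::nat" m] by (simp add: N_def)

lemma odd_N: "odd N"
  using m_pos by (simp add: N_def)

lemma power_N: "x \<noteq> 0 \<Longrightarrow> x ^ N = 1" for x :: 'a
  using finite_field_power_card_minus_one[of x] by (simp add: card_field N_def)

lemma power_card: "x ^ (2 ^ m) = x" for x :: 'a
proof (cases "x = 0")
  case False
  have "x ^ (2 ^ m) = x ^ Suc N"
    by (simp only: Suc_N)
  then show ?thesis
    using power_N[OF False] by simp
qed (use m_pos in simp)

text \<open>The characteristic is read off from the cardinality: \<open>N\<close> is odd, so
  \<open>(-1) ^ N = -1\<close>, while every unit has \<open>N\<close>-th power 1.\<close>

lemma add_self: "x + x = 0" for x :: 'a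
proof -
  have "(-1 :: 'a) ^ N = -1"
    using odd_N by simp
  then have "(1::'a) = -1"
    using power_N[of "-1"] by (metis neg_equal_0_iff_equal zero_neq_one)
  then have "(1::'a) + 1 = 0"
    by (metis add.right_inverse)
  then have "x * (1 + 1) = 0"
    by (simp only: mult_zero_right)
  then show ?thesis
    by (simp only: distrib_left mult_1_right)
qed

lemma two_eq_zero: "(2::'a) = 0"
  using add_self[of 1] by simp

lemma add_self_left: "x + (x + y) = y" for x y :: 'a
  by (simp add: add_self flip: add.assoc)

lemma minus_eq_self: "- x = x" for x :: 'a
  using add_self[of x] by (simp add: add_eq_0_iff)

lemma diff_eq_add: "x - y = x + y" for x y :: 'a
  by (simp add: minus_eq_self[of y] diff_conv_add_uminus del: add_uminus_conv_diff)

lemma add_eq_zero_iff: "x + y = 0 \<longleftrightarrow> x = y" for x y :: 'a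
  using diff_eq_add[of x y] eq_iff_diff_eq_0[of x y] by metis

lemma of_bit_add: "(of_bit (x + y) :: 'a) = of_bit x + of_bit y"
  by (cases x; cases y) (simp_all add: add_self)

lemma frobenius_add: "(x + y) ^ (2 ^ k) = x ^ (2 ^ k) + y ^ (2 ^ k)" for x y :: 'a
proof (induction k)
  case (Suc k)
  have square: "(u + v)\<^sup>2 = u\<^sup>2 + v\<^sup>2" for u v :: 'a
  proof -
    have "(u + v)\<^sup>2 = u\<^sup>2 + v\<^sup>2 + (u * v + u * v)"
      by (simp add: power2_eq_square algebra_simps)
    then show ?thesis
      by (simp only: add_self add_0_right)
  qed
  have "(x + y) ^ (2 ^ Suc k) = ((x + y) ^ (2 ^ k))\<^sup>2"
    by (simp only: power_Suc2 power_mult)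
  also have "\<dots> = (x ^ (2 ^ k))\<^sup>2 + (y ^ (2 ^ k))\<^sup>2"
    by (simp only: Suc square)
  also have "\<dots> = x ^ (2 ^ Suc k) + y ^ (2 ^ Suc k)"
    by (simp only: power_Suc2 power_mult)
  finally show ?case .
qed simp

lemma frobenius_inj: "x ^ (2 ^ k) = y ^ (2 ^ k) \<longleftrightarrow> x = y" for x y :: 'a
proof -
  have "x ^ (2 ^ k) = y ^ (2 ^ k) \<longleftrightarrow> (x + y) ^ (2 ^ k) = 0"
    by (simp add: frobenius_add add_eq_zero_iff)
  then show ?thesis
    by (simp add: add_eq_zero_iff)
qed

lemma frobenius_bij: "bij (\<lambda>x::'a. x ^ (2 ^ k))"
  by (simp add: bij_def finite_UNIV_inj_surj frobenius_inj inj_def)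

lemma generator_nonzero: "\<alpha> \<noteq> 0"
proof -
  have "\<alpha> ^ 1 \<in> range (\<lambda>k::nat. \<alpha> ^ k)"
    by blast
  then show ?thesis
    using generator by (simp add: generates_units_def)
qed

lemma generator_power_mod: "\<alpha> ^ (k mod N) = \<alpha> ^ k"
proof -
  have "\<alpha> ^ k = \<alpha> ^ (N * (k div N) + k mod N)"
    by simp
  also have "\<dots> = \<alpha> ^ (k mod N)"
    using power_N[OF generator_nonzero] by (simp only: power_add power_mult) simp
  finally show ?thesis ..
qed

lemma generator_bij: "bij_betw (\<lambda>i. \<alpha> ^ i) {..<N} (UNIV - {0})"
proof -
  have "(\<lambda>i. \<alpha> ^ i) ` {..<N} = range (\<lambda>k::nat. \<alpha> ^ k)"
  proof (intro equalityI subsetI)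
    fix x assume "x \<in> range (\<lambda>k::nat. \<alpha> ^ k)"
    then obtain k where "x = \<alpha> ^ (k mod N)"
      using generator_power_mod by fastforce
    then show "x \<in> (\<lambda>i. \<alpha> ^ i) ` {..<N}"
      using N_pos by (metis image_eqI lessThan_iff mod_less_divisor)
  qed auto
  then have im: "(\<lambda>i. \<alpha> ^ i) ` {..<N} = UNIV - {0}"
    using generator by (simp add: generates_units_def)
  then have "card ((\<lambda>i. \<alpha> ^ i) ` {..<N}) = card {..<N}"
    by (simp add: card_Diff_singleton card_field N_def)
  then show ?thesis
    using im by (simp add: bij_betw_def eq_card_imp_inj_on)
qed

section \<open>Roots of unity and fixed points of Frobenius powers\<close>

lemma generator_power_eq_one_iff: "\<alpha> ^ k = 1 \<longleftrightarrow> N dvd k"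
proof -
  have "\<alpha> ^ k = 1 \<longleftrightarrow> \<alpha> ^ (k mod N) = \<alpha> ^ 0"
    by (simp add: generator_power_mod)
  also have "\<dots> \<longleftrightarrow> k mod N = 0"
    using generator_bij N_pos unfolding bij_betw_def
    by (metis inj_onD lessThan_iff mod_less_divisor)
  finally show ?thesis
    by (simp add: dvd_eq_mod_eq_0)
qed

text \<open>The units are cyclic of order \<open>N = r * k\<close>, and the \<open>r\<close>-th
  roots of unity are the \<open>r\<close> distinct powers of \<open>\<alpha> ^ k\<close>.\<close>

lemma card_roots_of_unity:
  assumes "r dvd N"
  shows "card {x::'a. x ^ r = 1} = r"
proof -
  obtain k where k: "N = r * k"
    using assms by blast
  have pos: "r > 0" "k > 0"
    using N_pos k by (metis gr0I mult_0 , metis gr0I mult_0_right)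
  have "{x::'a. x ^ r = 1} = (\<lambda>j. \<alpha> ^ (k * j)) ` {..<r}"
  proof (intro equalityI subsetI)
    fix x :: 'a assume "x \<in> {x. x ^ r = 1}"
    then have x: "x ^ r = 1" "x \<noteq> 0"
      using pos by (auto simp: power_0_left)
    then obtain i where i: "i < N" "x = \<alpha> ^ i"
      using generator_bij by (auto simp: bij_betw_def image_iff set_eq_iff)
    then have "N dvd i * r"
      using x by (simp add: flip: generator_power_eq_one_iff power_mult)
    then have "k dvd i"
      using pos by (simp add: k mult.commute)
    then obtain j where "i = k * j" ..
    then show "x \<in> (\<lambda>j. \<alpha> ^ (k * j)) ` {..<r}"
      using i pos by (auto simp: k mult.commute)
  next
    fix x assume "x \<in> (\<lambda>j. \<alpha> ^ (k * j)) ` {..<r}"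
    then obtain j where "x = \<alpha> ^ (k * j)"
      by blast
    then have "x ^ r = \<alpha> ^ (N * j)"
      by (simp add: k mult_ac flip: power_mult)
    then show "x \<in> {x. x ^ r = 1}"
      by (simp add: generator_power_eq_one_iff)
  qed
  moreover have "inj_on (\<lambda>j. \<alpha> ^ (k * j)) {..<r}"
  proof (rule inj_onI)
    fix i j assume ij: "i \<in> {..<r}" "j \<in> {..<r}" "\<alpha> ^ (k * i) = \<alpha> ^ (k * j)"
    then have "k * i < N" "k * j < N"
      using pos by (simp_all add: k mult.commute)
    then have "k * i = k * j"
      using generator_bij ij(3) unfolding bij_betw_def inj_on_def by blast
    then show "i = j"
      using pos by simp
  qed
  ultimately show ?thesis
    by (simp add: card_image)
qed

text \<open>By Bezout, \<open>gcd e m\<close> is a multiple of \<open>e\<close> minus a multiple of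
  \<open>m\<close>, and raising to the power \<open>2 ^ m\<close> is the identity.\<close>

lemma power_gcd_fixed:
  fixes x :: 'a
  assumes "x ^ (2 ^ e) = x" and "e > 0"
  shows "x ^ (2 ^ gcd e m) = x"
proof -
  obtain i j where ij: "e * i = m * j + gcd e m"
    using bezout_nat[of e m] assms by auto
  have "x = x ^ (2 ^ (e * i))"
    using power_power_fixed[OF assms(1)] by simp
  also have "\<dots> = (x ^ (2 ^ (m * j))) ^ (2 ^ gcd e m)"
    by (simp only: ij power_add power_mult[of x])
  also have "\<dots> = x ^ (2 ^ gcd e m)"
    using power_power_fixed[OF power_card] by simp
  finally show ?thesis ..
qed

text \<open>The exponent \<open>e\<close> can be replaced by \<open>gcd e m\<close>. The fixed
  points are then 0 and the roots of unity for \<open>2 ^ gcd e m - 1\<close>, a divisor of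
  \<open>N\<close>.\<close>

lemma card_frobenius_fixed:
  assumes "e > 0"
  shows "card {x::'a. x ^ (2 ^ e) = x} = 2 ^ gcd e m"
proof -
  let ?d = "gcd e m"
  have d: "?d > 0"
    using assms by simp
  have "x ^ (2 ^ e) = x \<longleftrightarrow> x ^ (2 ^ ?d) = x" for x :: 'a
    using power_gcd_fixed[OF _ assms] power_power_fixed[of x 2 ?d]
    by (metis dvdE gcd_dvd1)
  moreover have "x ^ (2 ^ ?d) = x \<longleftrightarrow> x = 0 \<or> x ^ (2 ^ ?d - 1) = 1" for x :: 'a
  proof -
    have "x ^ (2 ^ ?d) = x * x ^ (2 ^ ?d - 1)"
      by (simp flip: power_Suc)
    then show ?thesis
      by auto
  qed
  ultimately have "{x::'a. x ^ (2 ^ e) = x} = insert 0 {x. x ^ (2 ^ ?d - 1) = 1}"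
    by auto
  moreover have "(2::nat) ^ ?d - 1 > 0"
    using d one_less_power[of "2::nat" ?d] by linarith
  moreover have "2 ^ ?d - 1 dvd N"
  proof -
    obtain k where k: "m = ?d * k"
      by (meson dvdE gcd_dvd2)
    show ?thesis
      using minus_one_dvd_power_minus_one[of "2 ^ ?d" k] by (simp add: N_def flip: k power_mult)
  qed
  ultimately show ?thesis
    by (simp add: card_roots_of_unity power_0_left)
qed

end

section \<open>Codewords as sets of field elements\<close>

definition eval_F2 :: "'a::field \<Rightarrow> bit poly \<Rightarrow> 'a" where
  "eval_F2 \<beta> p = poly (map_poly of_bit p) \<beta>"

lemma is_root_F2_iff_eval: "is_root_F2 p \<beta> \<longleftrightarrow> eval_F2 \<beta> p = 0"
  by (simp add: is_root_F2_def eval_F2_def)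

lemma eval_F2_0 [simp]: "eval_F2 \<beta> 0 = 0"
  by (simp add: eval_F2_def)

lemma eval_F2_1 [simp]: "eval_F2 \<beta> 1 = 1"
  by (simp add: eval_F2_def)

lemma eval_F2_pCons: "eval_F2 \<beta> (pCons a p) = of_bit a + \<beta> * eval_F2 \<beta> p"
  by (simp add: eval_F2_def map_poly_pCons)

lemma eval_F2_monom: "eval_F2 \<beta> (monom 1 k) = \<beta> ^ k"
  by (simp add: eval_F2_def map_poly_monom poly_monom)

lemma eval_F2_Poly: "eval_F2 \<beta> (Poly c) = (\<Sum>i\<in>support c. \<beta> ^ i)"
proof -
  have "eval_F2 \<beta> (Poly c) = (\<Sum>i<length c. of_bit (c ! i) * \<beta> ^ i)"
  proof (induction c)
    case (Cons b c)
    have "(\<Sum>i<length (b # c). of_bit ((b # c) ! i) * \<beta> ^ i)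
        = of_bit b + \<beta> * (\<Sum>i<length c. of_bit (c ! i) * \<beta> ^ i)"
      by (simp only: list.size sum.lessThan_Suc_shift sum_distrib_left add_Suc_right add_0_right)
        (simp add: mult_ac)
    then show ?case
      by (simp add: eval_F2_pCons Cons)
  qed simp
  also have "\<dots> = (\<Sum>i\<in>support c. \<beta> ^ i)"
    by (rule sum.mono_neutral_cong_right) (auto simp: support_def)
  finally show ?thesis .
qed

lemma support_append_singleton:
  "support (c @ [b]) = support c \<union> (if b = 0 then {} else {length c})"
  by (auto simp: support_def nth_append less_Suc_eq)

lemma finite_support: "finite (support c)"
  by (simp add: support_def)

lemma sum_list_eq_0_iff_even_support: "sum_list c = 0 \<longleftrightarrow> even (card (support c))"
proof (induction c rule: rev_induct)
  case (snoc b c)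
  have "length c \<notin> support c"
    by (simp add: support_def)
  then show ?case
    using snoc by (cases b; cases "sum_list c") (auto simp: support_append_singleton finite_support)
qed (simp add: support_def)

text \<open>Reduction modulo x^k - 1 does not affect divisibility by a divisor of x^k - 1.\<close>

lemma cyclic_code_iff_dvd:
  assumes "g dvd monom 1 k - 1"
  shows "c \<in> cyclic_code k g \<longleftrightarrow> length c = k \<and> g dvd Poly c"
proof -
  have "(\<exists>a. (monom 1 k - 1) dvd (Poly c - a * g)) \<longleftrightarrow> g dvd Poly c"
  proof
    assume "\<exists>a. (monom 1 k - 1) dvd (Poly c - a * g)"
    then obtain a where "g dvd Poly c - a * g"
      using assms dvd_trans by blast
    then have "g dvd Poly c - a * g + a * g"
      by (intro dvd_add) simp_all
    then show "g dvd Poly c"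
      by (simp only: diff_add_cancel)
  next
    assume "g dvd Poly c"
    then obtain a where "Poly c = a * g"
      by (metis dvdE mult.commute)
    then have "Poly c - a * g = 0"
      by (simp only: diff_self)
    then show "\<exists>a. (monom 1 k - 1) dvd (Poly c - a * g)"
      by (metis dvd_0_right)
  qed
  then show ?thesis
    by (simp add: cyclic_code_def)
qed

section \<open>Minimal polynomials and the zeros of the code\<close>

context binary_field
begin

lemma eval_F2_add: "eval_F2 \<beta> (p + q) = eval_F2 \<beta> p + eval_F2 \<beta> q" for \<beta> :: 'a
proof -
  have "map_poly of_bit (p + q) = map_poly of_bit p + (map_poly of_bit q :: 'a poly)"
    by (rule poly_eqI) (simp only: coeff_map_poly coeff_add of_bit_add even_zero not_True_eq_False of_bool_eq)
  then show ?thesis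
    by (simp add: eval_F2_def)
qed

lemma eval_F2_diff: "eval_F2 \<beta> (p - q) = eval_F2 \<beta> p - eval_F2 \<beta> q" for \<beta> :: 'a
  using eval_F2_add[of \<beta> "p - q" q] by (simp only: diff_add_cancel add_diff_cancel_right')

lemma eval_F2_mult: "eval_F2 \<beta> (p * q) = eval_F2 \<beta> p * eval_F2 \<beta> q" for \<beta> :: 'a
proof (induction p)
  case (pCons a p)
  have "eval_F2 \<beta> (smult a q) = of_bit a * eval_F2 \<beta> q"
    by (cases a) simp_all
  then show ?case
    using pCons by (simp add: eval_F2_add eval_F2_pCons algebra_simps)
qed simp

text \<open>The definite description is justified as follows. Every element is a root of x^(2^m) -
  x, so a candidate exists; the difference of two distinct monic candidates would be nonzero, of
  smaller degree and with the same root.\<close>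

lemma min_poly_props:
  fixes \<beta> :: 'a
  shows "lead_coeff (min_poly \<beta>) = 1" (is ?lead)
    and "eval_F2 \<beta> (min_poly \<beta>) = 0" (is ?root)
    and "\<And>q. \<lbrakk>q \<noteq> 0; eval_F2 \<beta> q = 0\<rbrakk> \<Longrightarrow> degree (min_poly \<beta>) \<le> degree q"
proof -
  let ?P = "\<lambda>p. lead_coeff p = 1 \<and> is_root_F2 p \<beta> \<and>
     (\<forall>q. q \<noteq> 0 \<and> is_root_F2 q \<beta> \<longrightarrow> degree p \<le> degree q)"
  let ?x = "monom 1 (2 ^ m) - monom 1 1 :: bit poly"
  have "?x \<noteq> 0"
  proof
    assume "?x = 0"
    then have "degree (monom (1::bit) (2 ^ m)) = degree (monom (1::bit) 1)"
      by (simp only: eq_iff_diff_eq_0[symmetric])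
    then show False
      using m_pos by (simp add: degree_monom_eq)
  qed
  then have "?x \<noteq> 0 \<and> eval_F2 \<beta> ?x = 0"
    by (simp only: eval_F2_diff eval_F2_monom power_card power_one_right diff_self) simp
  then obtain p where p: "p \<noteq> 0 \<and> eval_F2 \<beta> p = 0"
    and least: "\<forall>q. q \<noteq> 0 \<and> eval_F2 \<beta> q = 0 \<longrightarrow> degree p \<le> degree q"
    using ex_has_least_nat[of "\<lambda>p. p \<noteq> 0 \<and> eval_F2 \<beta> p = 0" ?x degree] by blast
  \<comment> \<open>Over \<open>bit\<close> a nonzero leading coefficient is already 1.\<close>
  have ex: "?P p"
    using p least by (simp add: is_root_F2_iff_eval flip: bit_not_zero_iff)
  have "p1 = p2" if p1: "?P p1" and p2: "?P p2" for p1 p2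
  proof (rule ccontr)
    assume "p1 \<noteq> p2"
    have deg: "degree p1 = degree p2"
      using p1 p2 by (metis antisym leading_coeff_0_iff zero_neq_one)
    have "coeff (p1 - p2) (degree p1) = 0"
      using p1 p2 by (metis coeff_diff deg diff_self)
    moreover have "degree (p1 - p2) \<le> degree p1"
      using deg by (simp add: degree_diff_le)
    ultimately have "degree (p1 - p2) < degree p1"
      using eq_zero_or_degree_less[of "p1 - p2" "degree p1"] \<open>p1 \<noteq> p2\<close> by simp
    moreover have "is_root_F2 (p1 - p2) \<beta>"
      using p1 p2 by (simp add: is_root_F2_iff_eval eval_F2_diff)
    ultimately show False
      using p1 \<open>p1 \<noteq> p2\<close> by (metis eq_iff_diff_eq_0 leD)
  qed
  then have "?P (min_poly \<beta>)"
    unfolding min_poly_def using ex by (intro theI[of ?P p]) blast+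
  then show ?lead ?root and "\<And>q. \<lbrakk>q \<noteq> 0; eval_F2 \<beta> q = 0\<rbrakk> \<Longrightarrow> degree (min_poly \<beta>) \<le> degree q"
    by (simp_all add: is_root_F2_iff_eval)
qed

text \<open>The remainder of \<open>p\<close> on division by \<open>min_poly \<beta>\<close> also
  vanishes at \<open>\<beta>\<close>, and minimality of the degree forces it to be 0.\<close>

lemma min_poly_dvd_iff: "min_poly \<beta> dvd p \<longleftrightarrow> eval_F2 \<beta> p = 0" for \<beta> :: 'a
proof
  assume "min_poly \<beta> dvd p"
  then show "eval_F2 \<beta> p = 0"
    by (auto simp: eval_F2_mult min_poly_props(2))
next
  assume root: "eval_F2 \<beta> p = 0"
  let ?M = "min_poly \<beta>"
  have nz: "?M \<noteq> 0"
    using min_poly_props(1)[of \<beta>] by auto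
  have "eval_F2 \<beta> (p div ?M * ?M + p mod ?M) = 0"
    using root by (simp only: div_mult_mod_eq)
  then have "eval_F2 \<beta> (p mod ?M) = 0"
    by (simp only: eval_F2_add eval_F2_mult min_poly_props(2) mult_zero_right add_0_left)
  then have "p mod ?M = 0"
    using min_poly_props(3)[of "p mod ?M" \<beta>] degree_mod_less'[OF nz, of p] by linarith
  then show "?M dvd p"
    by (simp add: dvd_eq_mod_eq_0)
qed

text \<open>Both minimal polynomials divide x^N - 1, so membership means vanishing at
  \<open>\<alpha>\<close> and \<open>\<alpha> ^ k\<close>, which are two power sums over the
  support.\<close>

lemma cyclic_code_lcm_iff:
  "c \<in> cyclic_code N (lcm (min_poly \<alpha>) (min_poly (\<alpha> ^ k))) \<longleftrightarrow>
    length c = N \<and> (\<Sum>i\<in>support c. \<alpha> ^ i) = 0 \<and> (\<Sum>i\<in>support c. (\<alpha> ^ i) ^ k) = 0"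
proof -
  have "min_poly \<beta> dvd monom 1 N - 1" if "\<beta> \<noteq> 0" for \<beta> :: 'a
    using that by (simp add: min_poly_dvd_iff eval_F2_diff eval_F2_monom power_N)
  then have "lcm (min_poly \<alpha>) (min_poly (\<alpha> ^ k)) dvd monom 1 N - 1"
    using generator_nonzero by (intro lcm_least) simp_all
  moreover have "(\<alpha> ^ k) ^ i = (\<alpha> ^ i) ^ k" for i
    by (simp add: mult.commute flip: power_mult)
  ultimately show ?thesis
    by (simp add: cyclic_code_iff_dvd lcm_least_iff min_poly_dvd_iff eval_F2_Poly)
qed

section \<open>Supports of the extended code as sets of field elements\<close>

definition point :: "nat \<Rightarrow> 'a" where
  "point i = (if i < N then \<alpha> ^ i else 0)"

lemma point_bij: "bij_betw point {0..<2 ^ m} UNIV"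
proof -
  have "bij_betw point {..<N} (UNIV - {0})"
    using generator_bij by (rule bij_betw_cong[THEN iffD1, rotated]) (simp add: point_def)
  moreover have "bij_betw point {N} {0}"
    by (simp add: point_def bij_betw_def)
  ultimately have "bij_betw point ({..<N} \<union> {N}) ((UNIV - {0}) \<union> {0})"
    by (rule bij_betw_combine) simp
  moreover have "{..<N} \<union> {N} = {0..<2 ^ m}"
    by (auto simp flip: Suc_N)
  ultimately show ?thesis
    by simp
qed

text \<open>The parity position is sent to 0, and \<open>0 ^ k = 0\<close> because
  \<open>k > 0\<close>.\<close>

lemma sum_point_extended:
  assumes "length c = N" and "k > 0"
  shows "(\<Sum>i\<in>support (c @ [b]). point i ^ k) = (\<Sum>i\<in>support c. (\<alpha> ^ i) ^ k)"
proof -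
  have "(\<Sum>i\<in>support (c @ [b]). point i ^ k) = (\<Sum>i\<in>support c. point i ^ k)"
    by (rule sum.mono_neutral_right)
      (use assms in \<open>auto simp: support_append_singleton finite_support point_def split: if_splits\<close>)
  also have "\<dots> = (\<Sum>i\<in>support c. (\<alpha> ^ i) ^ k)"
    by (rule sum.cong) (use assms in \<open>auto simp: support_def point_def\<close>)
  finally show ?thesis .
qed

text \<open>In a set \<open>S\<close> of even size, \<open>N\<close> lies in \<open>S\<close>
  exactly when \<open>S - {N}\<close> has odd size. The parity bit is therefore automatically right,
  and only the two power sums remain as conditions.\<close>

lemma supports_extended_code:
  assumes "k > 0" and "even w"
  shows "{support c | c. c \<in> extended_code (cyclic_code N (lcm (min_poly \<alpha>) (min_poly (\<alpha> ^ k))))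
             \<and> hamming_weight c = w}
    = {S. S \<subseteq> {0..<2 ^ m} \<and> card S = w \<and> (\<Sum>i\<in>S. point i) = 0 \<and> (\<Sum>i\<in>S. point i ^ k) = 0}"
    (is "?L = ?R")
proof (intro equalityI subsetI)
  fix S assume "S \<in> ?L"
  then obtain c where c: "c \<in> cyclic_code N (lcm (min_poly \<alpha>) (min_poly (\<alpha> ^ k)))"
    and S: "S = support (c @ [sum_list c])" "card S = w"
    by (auto simp: extended_code_def hamming_weight_def)
  have "S \<subseteq> {0..<2 ^ m}"
    using c S(1) by (auto simp: cyclic_code_lcm_iff support_def simp flip: Suc_N)
  then show "S \<in> ?R"
    using c S sum_point_extended[of c k "sum_list c"] sum_point_extended[of c 1 "sum_list c"] assms(1)
    by (simp add: cyclic_code_lcm_iff)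
next
  fix S assume "S \<in> ?R"
  then have S: "S \<subseteq> {0..<2 ^ m}" "card S = w" "(\<Sum>i\<in>S. point i) = 0" "(\<Sum>i\<in>S. point i ^ k) = 0"
    by auto
  \<comment> \<open>The indicator vector of \<open>S\<close> without the parity position; appending
    \<open>sum_list c\<close> has to restore \<open>S\<close>.\<close>
  define c where "c = map (\<lambda>i. of_bool (i \<in> S) :: bit) [0..<N]"
  have len: "length c = N"
    by (simp add: c_def)
  have supp: "support c = S - {N}"
    using S(1) by (auto simp: support_def c_def simp flip: Suc_N)
  have fin: "finite S"
    using S(1) finite_subset by blast
  have "sum_list c = 0 \<longleftrightarrow> N \<notin> S"
  proof (cases "N \<in> S")
    case True
    then have "card S = Suc (card (S - {N}))"
      using fin by (rule card.remove[rotated])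
    then show ?thesis
      using True S(2) assms(2) by (auto simp: sum_list_eq_0_iff_even_support supp)
  next
    case False
    then show ?thesis
      using S(2) assms(2) by (simp add: sum_list_eq_0_iff_even_support supp)
  qed
  then have ext: "support (c @ [sum_list c]) = S"
    by (auto simp: support_append_singleton supp len)
  then have "c \<in> cyclic_code N (lcm (min_poly \<alpha>) (min_poly (\<alpha> ^ k)))"
    using S(3,4) len sum_point_extended[of c k "sum_list c"] sum_point_extended[of c 1 "sum_list c"]
      assms(1) by (simp add: cyclic_code_lcm_iff)
  then show "S \<in> ?L"
    using ext S(2) by (auto simp: extended_code_def hamming_weight_def)
qed

end

section \<open>Counting the blocks\<close>

locale gold_code = binary_field +
  fixes e :: nat
  assumes four_dvd_m: "4 dvd m" and gcd_m_e: "gcd m e = 2"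
begin

lemma e_pos: "e > 0"
  using gcd_m_e four_dvd_m by (cases "e = 0") auto

lemma m_ge_4: "m \<ge> 4"
  using four_dvd_m m_pos by (simp add: dvd_imp_le)

text \<open>This is the map called \<open>s\<close> in the opening comment;
  \<open>x * frob x\<close> is the power \<open>x ^ (1 + 2 ^ e)\<close> belonging to the second zero
  of the code.\<close>

definition frob :: "'a \<Rightarrow> 'a" where
  "frob x = x ^ (2 ^ e)"

lemma frob_add [simp]: "frob (x + y) = frob x + frob y"
  by (simp add: frob_def frobenius_add)

lemma frob_mult [simp]: "frob (x * y) = frob x * frob y"
  by (simp add: frob_def power_mult_distrib)

lemma frob_0 [simp]: "frob 0 = 0"
  by (simp add: frob_def)

lemma frob_1 [simp]: "frob 1 = 1"
  by (simp add: frob_def)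

lemma frob_sum: "frob (\<Sum>x\<in>A. f x) = (\<Sum>x\<in>A. frob (f x))"
  by (induction A rule: infinite_finite_induct) auto

lemma frob_eq_iff: "frob x = frob y \<longleftrightarrow> x = y"
  by (simp add: frob_def frobenius_inj)

lemma frob_surj: "\<exists>y. x = frob y"
  using frobenius_bij[of e] unfolding frob_def bij_def surj_def by blast

text \<open>The fixed fields of \<open>frob\<close> and of \<open>frob \<circ> frob\<close> are the subfields of order 4 and 16;
  the latter uses that \<open>m\<close> is divisible by 4 while \<open>e\<close> is not.\<close>

definition F4 :: "'a set" where "F4 = {x. frob x = x}"
definition F16 :: "'a set" where "F16 = {x. frob (frob x) = x}"

lemma card_F4: "card F4 = 4"
  using card_frobenius_fixed[OF e_pos] gcd_m_e by (simp add: F4_def frob_def gcd.commute)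

text \<open>Writing \<open>m = 4 * k\<close> and \<open>e = 2 * j\<close>, the value 2 of
  \<open>gcd m e\<close> makes \<open>2 * k\<close> and \<open>j\<close> coprime, so only the factor
  4 is common to \<open>4 * j\<close> and \<open>4 * k\<close>.\<close>

lemma gcd_double_e: "gcd (2 * e) m = 4"
proof -
  obtain k where k: "m = 4 * k"
    using four_dvd_m by blast
  obtain j where j: "e = 2 * j"
    using gcd_m_e by (metis dvdE gcd_dvd2)
  have "2 * gcd (2 * k) j = 2"
    using gcd_m_e gcd_mult_distrib_nat[of 2 "2 * k" j] by (simp add: k j)
  then have "coprime (2 * k) j"
    by (simp add: coprime_iff_gcd_eq_1)
  then have "coprime k j"
    by simp
  then have "gcd (4 * j) (4 * k) = 4"
    by (simp add: coprime_iff_gcd_eq_1 gcd.commute flip: gcd_mult_distrib_nat)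
  then show ?thesis
    by (simp add: k j)
qed

lemma card_F16: "card F16 = 16"
proof -
  have "frob (frob x) = x ^ (2 ^ (2 * e))" for x
    by (simp add: frob_def mult_2 power_add power_mult)
  then show ?thesis
    using card_frobenius_fixed[of "2 * e"] e_pos gcd_double_e by (simp add: F16_def)
qed

lemma zero_one_in_F4: "0 \<in> F4" "1 \<in> F4"
  by (simp_all add: F4_def)

section \<open>Counting all quadruples\<close>

text \<open>The ordered quadruples that complete 0, 1 to a solution, coincidences allowed.\<close>

definition T :: "('a \<times> 'a \<times> 'a \<times> 'a) set" where
  "T = {(a, b, c, d). a + b + c + d = 1 \<and>
     a * frob a + b * frob b + c * frob c + d * frob d = 1}"

text \<open>For \<open>r\<close> outside \<open>F16\<close> the coefficient of \<open>s\<close> is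
  invertible, and \<open>r\<close>, \<open>u\<close> determine \<open>s\<close>. For
  \<open>r\<close> in \<open>F16\<close> the left side is 0, so \<open>u\<close> lies in
  \<open>F4\<close> and \<open>s\<close> is free. This gives (q - 16) q + 64 q solutions.\<close>

lemma card_solutions:
  "card {(s, r, u). s * (frob (frob r) + r) = frob u + u} = (CARD('a))\<^sup>2 + 48 * CARD('a)" (is "card ?X = _")
proof -
  let ?v = "\<lambda>r. frob (frob r) + r"
  let ?f = "\<lambda>(r, u). ((frob u + u) / ?v r, r, u)"
  have v: "?v r = 0 \<longleftrightarrow> r \<in> F16" for r
    by (simp add: F16_def add_eq_zero_iff)
  have "?X = ?f ` ((UNIV - F16) \<times> UNIV) \<union> UNIV \<times> F16 \<times> F4" (is "_ = ?A \<union> ?B")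
  proof (intro equalityI subsetI)
    fix x assume "x \<in> ?X"
    then obtain s r u where x: "x = (s, r, u)" "s * ?v r = frob u + u"
      by auto
    show "x \<in> ?A \<union> ?B"
    proof (cases "r \<in> F16")
      case True
      then have "frob u + u = 0"
        using v[of r] x(2) by (metis mult_zero_right)
      then have "u \<in> F4"
        by (simp add: F4_def add_eq_zero_iff)
      then show ?thesis
        using True x by simp
    next
      case False
      then have "s = (frob u + u) / ?v r"
        using v[of r] x(2) by (simp add: eq_divide_eq)
      then show ?thesis
        using False x by force
    qed
  next
    fix x assume "x \<in> ?A \<union> ?B"
    then show "x \<in> ?X"
    proof
      assume "x \<in> ?A"
      then obtain r u where "r \<notin> F16" "x = ((frob u + u) / ?v r, r, u)"
        by auto
      then show ?thesis
        using v[of r] by simp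
    next
      assume "x \<in> ?B"
      then obtain s r u where "x = (s, r, u)" "r \<in> F16" "u \<in> F4"
        by auto
      then show ?thesis
        using v[of r] by (simp add: F4_def two_eq_zero)
    qed
  qed
  moreover have "?A \<inter> ?B = {}"
    by auto
  moreover have "card ?A = (CARD('a) - 16) * CARD('a)"
  proof -
    have "inj_on ?f ((UNIV - F16) \<times> UNIV)"
      by (auto simp: inj_on_def)
    then have "card ?A = card ((UNIV - F16) \<times> (UNIV :: 'a set))"
      by (rule card_image)
    then show ?thesis
      by (simp add: card_cartesian_product card_Diff_subset card_F16)
  qed
  moreover have "card ?B = CARD('a) * (16 * 4)"
    by (simp add: card_cartesian_product card_F16 card_F4)
  ultimately have "card ?X = (CARD('a) - 16) * CARD('a) + CARD('a) * (16 * 4)"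
    by (simp add: card_Un_disjoint)
  \<comment> \<open>This makes the truncated subtraction \<open>CARD('a) - 16\<close> a true
    one.\<close>
  moreover have "CARD('a) \<ge> 16"
    using card_mono[of UNIV F16] by (simp add: card_F16)
  ultimately show ?thesis
    by (simp add: power2_eq_square diff_mult_distrib)
qed

lemmas char2_simps = algebra_simps add_self add_self_left

text \<open>With \<open>s = a + b\<close>, \<open>t = a + c\<close> and \<open>u = a + b + c\<close> the quadratic equation becomes
  \<open>s * frob t + frob s * t = frob u + u\<close>; writing \<open>t = frob r\<close> and shifting \<open>u\<close> by \<open>s * r\<close>
  makes it linear in \<open>s\<close>.\<close>

lemma card_T: "card T = (CARD('a))\<^sup>2 + 48 * CARD('a)"
proof -
  let ?X = "{(s, r, u). s * (frob (frob r) + r) = frob u + u}"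
  \<comment> \<open>The inverse substitution: \<open>u + s * r\<close> is a + b + c,
    \<open>s\<close> is a + b and \<open>frob r\<close> is a + c, from which the entries are
    recovered by addition.\<close>
  let ?f = "\<lambda>(s, r, u). (u + s * r + s + frob r, u + s * r + frob r, u + s * r + s, u + s * r + 1)"
  have mem: "?f (s, r, u) \<in> T \<longleftrightarrow> (s, r, u) \<in> ?X" for s r u
  proof -
    have "?f (s, r, u) \<in> T \<longleftrightarrow> s * (frob (frob r) + r) + (frob u + u) = 0"
      by (simp add: T_def char2_simps)
    then show ?thesis
      by (simp add: add_eq_zero_iff)
  qed
  have "T = ?f ` ?X"
  proof (intro equalityI subsetI)
    fix x assume "x \<in> T"
    then obtain a b c d where x: "x = (a, b, c, d)" "a + b + c + d = 1"
      by (auto simp: T_def)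
    obtain r where r: "a + c = frob r"
      using frob_surj by blast
    let ?s = "a + b" and ?u = "a + b + c + (a + b) * r"
    have "d = a + b + c + (a + b + c + d)"
      by (simp add: char2_simps)
    then have "d = a + b + c + 1"
      by (simp only: x(2))
    then have "x = ?f (?s, r, ?u)"
      by (simp add: x r[symmetric] char2_simps)
    then show "x \<in> ?f ` ?X"
      using \<open>x \<in> T\<close> mem[of ?s r ?u] by blast
  qed (use mem in auto)
  moreover have "inj_on ?f ?X"
  proof (rule inj_onI)
    fix x x' assume f: "?f x = ?f x'"
    obtain s r u s' r' u' where x: "x = (s, r, u)" "x' = (s', r', u')"
      by (metis prod_cases3)
    have 1: "u + s * r = u' + s' * r'"
      using f by (simp add: x)
    then have "s = s'" "frob r = frob r'"
      using f by (simp_all add: x)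
    then show "x = x'"
      using 1 by (simp add: x frob_eq_iff)
  qed
  ultimately show ?thesis
    by (simp add: card_image card_solutions)
qed

section \<open>Quadruples with a coincidence\<close>

lemma T_swap:
  "(b, a, c, d) \<in> T \<longleftrightarrow> (a, b, c, d) \<in> T"
  "(a, c, b, d) \<in> T \<longleftrightarrow> (a, b, c, d) \<in> T"
  "(a, b, d, c) \<in> T \<longleftrightarrow> (a, b, c, d) \<in> T"
  by (simp_all add: T_def ac_simps)

text \<open>Equal entries cancel in both equations. With \<open>d = c + 1\<close>, what remains of
  the second one is \<open>frob c = c\<close>.\<close>

lemma T_pair:
  "(z, z, c, d) \<in> T \<longleftrightarrow> d = c + 1 \<and> c \<in> F4"
proof -
  have "(z, z, c, d) \<in> T \<longleftrightarrow> c + d = 1 \<and> c * frob c + d * frob d = 1"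
    by (simp add: T_def add_self)
  also have "\<dots> \<longleftrightarrow> d = c + 1 \<and> c * frob c + (c + 1) * frob (c + 1) = 1"
    by (metis add.left_commute add_self_left)
  also have "c * frob c + (c + 1) * frob (c + 1) = 1 \<longleftrightarrow> c + frob c = 0"
    by (simp add: char2_simps)
  finally show ?thesis
    by (auto simp: add_eq_zero_iff F4_def)
qed

lemma T_pairs:
  "(z, c, z, d) \<in> T \<longleftrightarrow> d = c + 1 \<and> c \<in> F4"
  "(z, c, d, z) \<in> T \<longleftrightarrow> d = c + 1 \<and> c \<in> F4"
  "(c, z, z, d) \<in> T \<longleftrightarrow> d = c + 1 \<and> c \<in> F4"
  "(c, z, d, z) \<in> T \<longleftrightarrow> d = c + 1 \<and> c \<in> F4"
  "(c, d, z, z) \<in> T \<longleftrightarrow> d = c + 1 \<and> c \<in> F4"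
  using T_pair T_swap by metis+

text \<open>The codewords of weight 4 are the affine lines over \<open>F4\<close>; these are the lines through 0
  that avoid 1, parametrized by a point \<open>y\<close> and the ratio \<open>w\<close> of two further points.\<close>

definition line_params :: "('a \<times> 'a) set" where
  "line_params = {(w, y). w \<in> F4 \<and> w \<noteq> 0 \<and> w \<noteq> 1 \<and>
     y \<noteq> 0 \<and> y \<noteq> 1 \<and> w * y \<noteq> 1 \<and> (w + 1) * y \<noteq> 1}"

text \<open>Here \<open>z\<close> is the repeated entry and \<open>c\<close>, \<open>c + 1\<close>
  are the other two; the excluded values of \<open>z\<close> would produce a triple
  coincidence.\<close>

definition pair_params :: "('a \<times> 'a) set" where
  "pair_params = {(c, z). c \<in> F4 \<and> z \<noteq> c \<and> z \<noteq> c + 1}"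

lemma card_pair_params: "card pair_params = 4 * (CARD('a) - 2)"
proof -
  have "pair_params = Sigma F4 (\<lambda>c. UNIV - {c, c + 1})"
    by (auto simp: pair_params_def)
  moreover have "card (UNIV - {c, c + 1}) = CARD('a) - 2" for c :: 'a
    by (subst card_Diff_subset) auto
  ultimately show ?thesis
    by (simp add: card_F4)
qed

text \<open>There are two choices of \<open>w\<close>, and each excludes the four values 0, 1,
  \<open>1 / w\<close> and \<open>1 / (w + 1)\<close> of \<open>y\<close>, which are distinct
  because \<open>w\<close> is neither 0 nor 1.\<close>

lemma card_line_params: "card line_params = 2 * (CARD('a) - 4)"
proof -
  have "line_params = Sigma (F4 - {0, 1}) (\<lambda>w. UNIV - {0, 1, 1 / w, 1 / (w + 1)})"
  proof -
    have "w * y = 1 \<longleftrightarrow> y = 1 / w" "(w + 1) * y = 1 \<longleftrightarrow> y = 1 / (w + 1)"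
      if "w \<noteq> 0" "w \<noteq> 1" for w y :: 'a
      using that add_eq_zero_iff[of w 1] by (simp_all add: eq_divide_eq mult.commute)
    then show ?thesis
      by (auto simp: line_params_def)
  qed
  moreover have "card (UNIV - {0, 1, 1 / w, 1 / (w + 1)}) = CARD('a) - 4" if "w \<in> F4 - {0, 1}" for w
  proof -
    have "card {0, 1, 1 / w, 1 / (w + 1)} = 4"
      using that add_eq_zero_iff[of w 1] by (auto simp: field_simps)
    then show ?thesis
      by (simp add: card_Diff_subset)
  qed
  moreover have "card (F4 - {0, 1}) = 2"
    using card_Diff_subset[of "{0, 1}" F4] by (simp add: zero_one_in_F4 card_F4)
  ultimately show ?thesis
    by simp
qed

text \<open>The entry 1 uses up both right-hand sides, leaving \<open>d = b + c\<close> and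
  \<open>b * frob c = c * frob b\<close>. The latter says that the ratio \<open>w = b / c\<close> is
  fixed by \<open>frob\<close>.\<close>

lemma T_one:
  assumes "b \<noteq> c" "b \<noteq> d" "c \<noteq> d"
  shows "(1, b, c, d) \<in> T \<and> b \<noteq> 0 \<and> c \<noteq> 0 \<and> d \<noteq> 0 \<and> b \<noteq> 1 \<and> c \<noteq> 1 \<and> d \<noteq> 1
    \<longleftrightarrow> (\<exists>(w, y) \<in> line_params. b = w * y \<and> c = y \<and> d = (w + 1) * y)"
    (is "?L \<longleftrightarrow> ?R")
proof
  assume L: ?L
  then have "b + (c + d) = 0"
    by (simp add: T_def ac_simps)
  then have d: "d = b + c"
    by (simp add: add_eq_zero_iff flip: add.assoc)
  have "b * frob b + (c * frob c + d * frob d) = 0"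
    using L by (simp add: T_def ac_simps)
  then have "b * frob c + c * frob b = 0"
    by (simp add: d char2_simps)
  then have bc: "b * frob c = c * frob b"
    by (simp add: add_eq_zero_iff)
  let ?w = "b / c"
  have w: "b = ?w * c"
    using L by simp
  have "frob b = frob ?w * frob c"
    using w frob_mult by metis
  moreover have "frob c \<noteq> 0"
    using L frob_eq_iff[of c 0] by simp
  ultimately have "?w \<in> F4"
    using bc L by (simp add: F4_def field_simps)
  moreover have "d = (?w + 1) * c"
    using L by (simp add: d field_simps)
  ultimately have "(?w, c) \<in> line_params"
    using L assms w by (auto simp: line_params_def)
  then show ?R
    using w \<open>d = (?w + 1) * c\<close> by blast
next
  assume ?R
  then obtain w y where wy: "(w, y) \<in> line_params" "b = w * y" "c = y" "d = (w + 1) * y"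
    by blast
  then have "frob w = w"
    by (simp add: line_params_def F4_def)
  then have "(1, b, c, d) \<in> T"
    by (simp add: T_def wy char2_simps)
  then show ?L
    using wy add_eq_zero_iff[of w 1] by (auto simp: line_params_def)
qed

text \<open>Adding 1 exchanges the two given points 0 and 1. The second sum changes by the entry sum
  plus its image under \<open>frob\<close>, which is 1 + 1 = 0 when the entry sum is 1.\<close>

lemma T_translate: "(a + 1, b + 1, c + 1, d + 1) \<in> T \<longleftrightarrow> (a, b, c, d) \<in> T"
proof -
  have "(a + 1) + (b + 1) + (c + 1) + (d + 1) = a + b + c + d"
    by (simp add: char2_simps)
  moreover have "(a + 1) * frob (a + 1) + (b + 1) * frob (b + 1) + (c + 1) * frob (c + 1)
      + (d + 1) * frob (d + 1)
    = (a * frob a + b * frob b + c * frob c + d * frob d) + (a + b + c + d) + frob (a + b + c + d)"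
    by (simp add: char2_simps)
  moreover have "x + 1 + frob 1 = x" for x :: 'a
    by (simp add: char2_simps)
  ultimately show ?thesis
    unfolding T_def mem_Collect_eq case_prod_conv by metis
qed

text \<open>Translation by 1 turns the entry 0 into 1 and reduces the claim to
  \<open>T_one\<close>.\<close>

lemma T_zero:
  assumes "b \<noteq> c" "b \<noteq> d" "c \<noteq> d"
  shows "(0, b, c, d) \<in> T \<and> b \<noteq> 0 \<and> c \<noteq> 0 \<and> d \<noteq> 0
    \<longleftrightarrow> (\<exists>(w, y) \<in> line_params. b = w * y + 1 \<and> c = y + 1 \<and> d = (w + 1) * y + 1)"
proof -
  have eq: "x + 1 = z \<longleftrightarrow> x = z + 1" for x z :: 'a
    by (metis add.commute add_self_left)
  have ne: "x + 1 \<noteq> 1 \<longleftrightarrow> x \<noteq> 0" "x + 1 \<noteq> 0 \<longleftrightarrow> x \<noteq> 1" for x :: 'a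
    by (simp_all add: add_eq_zero_iff)
  \<comment> \<open>Entries 0 and 1 together would leave two entries with sum 0, hence
    equal.\<close>
  have no1: "x \<noteq> 1" if T: "(0, b, c, d) \<in> T" and x: "x \<in> {b, c, d}" for x
  proof
    assume "x = 1"
    then consider "b = 1" | "c = 1" | "d = 1"
      using x by auto
    then show False
      using T assms by cases (auto simp: T_def add_eq_zero_iff algebra_simps)
  qed
  have "(1, b + 1, c + 1, d + 1) \<in> T \<longleftrightarrow> (0, b, c, d) \<in> T"
    using T_translate[of 0 b c d] by simp
  then have "(0, b, c, d) \<in> T \<and> b \<noteq> 0 \<and> c \<noteq> 0 \<and> d \<noteq> 0 \<longleftrightarrow>
    (\<exists>(w, y) \<in> line_params. b + 1 = w * y \<and> c + 1 = y \<and> d + 1 = (w + 1) * y)"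
    using T_one[of "b + 1" "c + 1" "d + 1"] assms no1 by (simp add: ne) blast
  then show ?thesis
    by (simp only: eq)
qed

lemma line_params_distinct:
  assumes "(w, y) \<in> line_params"
  shows "w * y \<noteq> y" "w * y \<noteq> (w + 1) * y" "y \<noteq> (w + 1) * y"
  using assms by (auto simp: line_params_def)

definition zero_triples :: "('a \<times> 'a \<times> 'a) set" where
  "zero_triples = {(b, c, d). (0, b, c, d) \<in> T \<and> distinct [0, b, c, d]}"

text \<open>The value 0 is excluded as well because \<open>kind\<close> looks for an entry 0 before
  an entry 1.\<close>

definition one_triples :: "('a \<times> 'a \<times> 'a) set" where
  "one_triples = {(b, c, d). (1, b, c, d) \<in> T \<and> distinct [0, 1, b, c, d]}"

lemma card_zero_triples: "card zero_triples = 2 * (CARD('a) - 4)"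
proof -
  let ?f = "\<lambda>(w, y). (w * y + 1, y + 1, (w + 1) * y + 1)"
  have "zero_triples = ?f ` line_params"
  proof (intro equalityI subsetI)
    fix x assume "x \<in> zero_triples"
    then obtain b c d where x: "x = (b, c, d)" "(0, b, c, d) \<in> T" "distinct [0, b, c, d]"
      by (auto simp: zero_triples_def)
    then have "\<exists>(w, y) \<in> line_params. b = w * y + 1 \<and> c = y + 1 \<and> d = (w + 1) * y + 1"
      by (intro T_zero[THEN iffD1]) auto
    then show "x \<in> ?f ` line_params"
      using x(1) by force
  next
    fix x assume "x \<in> ?f ` line_params"
    then obtain w y where wy: "(w, y) \<in> line_params" "x = ?f (w, y)"
      by auto
    let ?b = "w * y + 1" and ?c = "y + 1" and ?d = "(w + 1) * y + 1"
    have ne: "?b \<noteq> ?c" "?b \<noteq> ?d" "?c \<noteq> ?d"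
      using line_params_distinct[OF wy(1)] by auto
    then have "(0, ?b, ?c, ?d) \<in> T \<and> ?b \<noteq> 0 \<and> ?c \<noteq> 0 \<and> ?d \<noteq> 0"
      using wy(1) by (intro T_zero[THEN iffD2]) blast+
    then show "x \<in> zero_triples"
      using ne unfolding zero_triples_def wy(2) case_prod_conv mem_Collect_eq by simp
  qed
  moreover have "inj_on ?f line_params"
    by (auto simp: inj_on_def line_params_def)
  ultimately show ?thesis
    by (simp add: card_image card_line_params)
qed

lemma card_one_triples: "card one_triples = 2 * (CARD('a) - 4)"
proof -
  let ?f = "\<lambda>(w, y). (w * y, y, (w + 1) * y)"
  have "one_triples = ?f ` line_params"
  proof (intro equalityI subsetI)
    fix x assume "x \<in> one_triples"
    then obtain b c d where x: "x = (b, c, d)" "(1, b, c, d) \<in> T" "distinct [0, 1, b, c, d]"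
      by (auto simp: one_triples_def)
    then have "\<exists>(w, y) \<in> line_params. b = w * y \<and> c = y \<and> d = (w + 1) * y"
      by (intro T_one[THEN iffD1]) auto
    then show "x \<in> ?f ` line_params"
      using x(1) by force
  next
    fix x assume "x \<in> ?f ` line_params"
    then obtain w y where wy: "(w, y) \<in> line_params" "x = ?f (w, y)"
      by auto
    let ?b = "w * y" and ?c = "y" and ?d = "(w + 1) * y"
    have ne: "?b \<noteq> ?c" "?b \<noteq> ?d" "?c \<noteq> ?d"
      using line_params_distinct[OF wy(1)] by auto
    then have "(1, ?b, ?c, ?d) \<in> T \<and> ?b \<noteq> 0 \<and> ?c \<noteq> 0 \<and> ?d \<noteq> 0 \<and> ?b \<noteq> 1 \<and> ?c \<noteq> 1 \<and> ?d \<noteq> 1"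
      using wy(1) by (intro T_one[THEN iffD2]) blast+
    then show "x \<in> one_triples"
      using ne unfolding one_triples_def wy(2) case_prod_conv mem_Collect_eq
      by (simp only: distinct.simps list.set) auto
  qed
  moreover have "inj_on ?f line_params"
    by (auto simp: inj_on_def line_params_def)
  ultimately show ?thesis
    by (simp add: card_image card_line_params)
qed

section \<open>Sorting the quadruples by their coincidences\<close>

text \<open>The kind of a quadruple records which coincidence among 0, 1 and its entries occurs:
  a repeated entry (1 to 10), an entry 0 (11 to 14), an entry 1 (15 to 18), none (0).\<close>

definition kind :: "'a \<times> 'a \<times> 'a \<times> 'a \<Rightarrow> nat" where
  "kind = (\<lambda>(a, b, c, d).
     if a = b then (if a = c then 1 else if a = d then 2 else 3)
     else if a = c then (if a = d then 4 else 5)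
     else if a = d then 6
     else if b = c then (if b = d then 7 else 8)
     else if b = d then 9
     else if c = d then 10
     else if a = 0 then 11 else if b = 0 then 12 else if c = 0 then 13 else if d = 0 then 14
     else if a = 1 then 15 else if b = 1 then 16 else if c = 1 then 17 else if d = 1 then 18
     else 0)"

lemma kind_le: "kind t \<le> 18"
  by (cases t) (simp add: kind_def)

lemma kind_eq_0_iff: "kind (a, b, c, d) = 0 \<longleftrightarrow> distinct [0, 1, a, b, c, d]"
  by (simp add: kind_def if_distrib[where f = "\<lambda>k. k = 0"] split del: if_split cong: if_cong) auto

text \<open>The odd entry and the repeated one differ by 1 and lie in \<open>F4\<close>, so one
  element of \<open>F4\<close> determines the quadruple.\<close>

lemma card_kind_triple_equal:
  "card {t \<in> T. kind t = 1} = 4" "card {t \<in> T. kind t = 2} = 4"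
  "card {t \<in> T. kind t = 4} = 4" "card {t \<in> T. kind t = 7} = 4"
proof -
  have "{t \<in> T. kind t = 1} = (\<lambda>c. (c, c, c, c + 1)) ` F4"
    by (auto simp: kind_def T_pair T_pairs split: if_splits)
  then show "card {t \<in> T. kind t = 1} = 4"
    by (simp add: card_image inj_on_def card_F4)
  have "{t \<in> T. kind t = 2} = (\<lambda>c. (c + 1, c + 1, c, c + 1)) ` F4"
    by (auto simp: kind_def T_pair T_pairs split: if_splits)
  then show "card {t \<in> T. kind t = 2} = 4"
    by (simp add: card_image inj_on_def card_F4)
  have "{t \<in> T. kind t = 4} = (\<lambda>c. (c + 1, c, c + 1, c + 1)) ` F4"
    by (auto simp: kind_def T_pair T_pairs split: if_splits)
  then show "card {t \<in> T. kind t = 4} = 4"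
    by (simp add: card_image inj_on_def card_F4)
  have "{t \<in> T. kind t = 7} = (\<lambda>c. (c, c + 1, c + 1, c + 1)) ` F4"
    by (auto simp: kind_def T_pair T_pairs split: if_splits)
  then show "card {t \<in> T. kind t = 7} = 4"
    by (simp add: card_image inj_on_def card_F4)
qed

lemma card_kind_pair_equal:
  assumes "k \<in> {3, 5, 6, 8, 9, 10}"
  shows "card {t \<in> T. kind t = k} = 4 * (CARD('a) - 2)"
proof -
  have "{t \<in> T. kind t = 3} = (\<lambda>(c, z). (z, z, c, c + 1)) ` pair_params"
    "{t \<in> T. kind t = 5} = (\<lambda>(c, z). (z, c, z, c + 1)) ` pair_params"
    "{t \<in> T. kind t = 6} = (\<lambda>(c, z). (z, c, c + 1, z)) ` pair_params"
    "{t \<in> T. kind t = 8} = (\<lambda>(c, z). (c, z, z, c + 1)) ` pair_params"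
    "{t \<in> T. kind t = 9} = (\<lambda>(c, z). (c, z, c + 1, z)) ` pair_params"
    "{t \<in> T. kind t = 10} = (\<lambda>(c, z). (c, c + 1, z, z)) ` pair_params"
    by (auto simp: kind_def T_pair T_pairs pair_params_def image_iff split: if_splits)
  moreover have "inj_on (\<lambda>(c, z). (z, z, c, c + 1)) pair_params"
    "inj_on (\<lambda>(c, z). (z, c, z, c + 1)) pair_params"
    "inj_on (\<lambda>(c, z). (z, c, c + 1, z)) pair_params"
    "inj_on (\<lambda>(c, z). (c, z, z, c + 1)) pair_params"
    "inj_on (\<lambda>(c, z). (c, z, c + 1, z)) pair_params"
    "inj_on (\<lambda>(c, z). (c, c + 1, z, z)) pair_params"
    by (auto simp: inj_on_def)
  ultimately show ?thesis
    using assms by (auto simp: card_image card_pair_params)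
qed

lemma T_to_front:
  "(b, a, c, d) \<in> T \<longleftrightarrow> (a, b, c, d) \<in> T"
  "(b, c, a, d) \<in> T \<longleftrightarrow> (a, b, c, d) \<in> T"
  "(b, c, d, a) \<in> T \<longleftrightarrow> (a, b, c, d) \<in> T"
  by (simp_all add: T_def ac_simps)

text \<open>By symmetry of \<open>T\<close> the special entry can be moved to the front, so each of
  its positions contributes a copy of \<open>zero_triples\<close> or
  \<open>one_triples\<close>.\<close>

lemma card_kind_zero_or_one:
  assumes "k \<in> {11..18}"
  shows "card {t \<in> T. kind t = k} = 2 * (CARD('a) - 4)"
proof -
  have "{t \<in> T. kind t = 11} = (\<lambda>(b, c, d). (0, b, c, d)) ` zero_triples"
    "{t \<in> T. kind t = 12} = (\<lambda>(b, c, d). (b, 0, c, d)) ` zero_triples"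
    "{t \<in> T. kind t = 13} = (\<lambda>(b, c, d). (b, c, 0, d)) ` zero_triples"
    "{t \<in> T. kind t = 14} = (\<lambda>(b, c, d). (b, c, d, 0)) ` zero_triples"
    by (auto simp: kind_def T_to_front[where a = 0] zero_triples_def image_iff split: if_splits)
  moreover have "{t \<in> T. kind t = 15} = (\<lambda>(b, c, d). (1, b, c, d)) ` one_triples"
    "{t \<in> T. kind t = 16} = (\<lambda>(b, c, d). (b, 1, c, d)) ` one_triples"
    "{t \<in> T. kind t = 17} = (\<lambda>(b, c, d). (b, c, 1, d)) ` one_triples"
    "{t \<in> T. kind t = 18} = (\<lambda>(b, c, d). (b, c, d, 1)) ` one_triples"
    by (auto simp: kind_def T_to_front[where a = 1] one_triples_def image_iff split: if_splits)
  moreover have "inj_on (\<lambda>(b, c, d). (x, b, c, d)) A" "inj_on (\<lambda>(b, c, d). (b, x, c, d)) A"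
    "inj_on (\<lambda>(b, c, d). (b, c, x, d)) A" "inj_on (\<lambda>(b, c, d). (b, c, d, x)) A"
    for A :: "('a \<times> 'a \<times> 'a) set" and x :: 'a
    by (auto simp: inj_on_def)
  moreover have "k = 11 \<or> k = 12 \<or> k = 13 \<or> k = 14 \<or> k = 15 \<or> k = 16 \<or> k = 17 \<or> k = 18"
    using assms by auto
  ultimately show ?thesis
    by (elim disjE) (simp_all add: card_image card_zero_triples card_one_triples)
qed

text \<open>Removing the kinds 1 to 18 leaves q^2 + 48 q - 16 - 24 (q - 2) - 16 (q - 4)
  quadruples.\<close>

lemma card_T_distinct:
  "card {(a, b, c, d) \<in> T. distinct [0, 1, a, b, c, d]} = (CARD('a))\<^sup>2 + 8 * CARD('a) + 96"
proof -
  have "{(a, b, c, d) \<in> T. distinct [0, 1, a, b, c, d]} = {t \<in> T. kind t = 0}" (is "?D = _")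
    by (auto simp only: kind_eq_0_iff)
  moreover have "card T = (\<Sum>k\<le>18. card {t \<in> T. kind t = k})"
    using sum.group[of T "{..18}" kind "\<lambda>_. 1::nat"] kind_le by (simp add: image_subset_iff)
  moreover have "(\<Sum>k\<le>18. f k) = f 0 + (f 1 + f 2 + f 4 + f 7) + (\<Sum>k\<in>{3, 5, 6, 8, 9, 10}. f k)
      + (\<Sum>k\<in>{11..18}. f k)" for f :: "nat \<Rightarrow> nat"
  proof -
    have "{..18} = {0, 1, 2, 4, 7} \<union> {3, 5, 6, 8, 9, 10} \<union> {11..18::nat}"
      by auto presburger
    then have "(\<Sum>k\<le>18. f k) = sum f {0, 1, 2, 4, 7} + sum f {3, 5, 6, 8, 9, 10} + sum f {11..18}"
      by (simp only:) (subst sum.union_disjoint; simp)+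
    then show ?thesis
      by simp
  qed
  moreover have "(\<Sum>k\<in>{3, 5, 6, 8, 9, 10}. card {t \<in> T. kind t = k}) = 6 * (4 * (CARD('a) - 2))"
    using card_kind_pair_equal by simp
  moreover have "(\<Sum>k\<in>{11..18}. card {t \<in> T. kind t = k}) = 8 * (2 * (CARD('a) - 4))"
    using card_kind_zero_or_one by simp
  ultimately have "card T = card ?D + (4 + 4 + 4 + 4) + 6 * (4 * (CARD('a) - 2)) + 8 * (2 * (CARD('a) - 4))"
    by (simp only: card_kind_triple_equal)
  moreover have "CARD('a) \<ge> 16"
    using card_mono[of UNIV F16] by (simp add: card_F16)
  ultimately show ?thesis
    by (simp add: card_T)
qed

section \<open>Affine invariance and the design\<close>

definition blocks :: "'a set set" where
  "blocks = {A. card A = 6 \<and> (\<Sum>x\<in>A. x) = 0 \<and> (\<Sum>x\<in>A. x * frob x) = 0}"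

text \<open>Expanding both sums leaves multiples of the two defining sums, of the
  \<open>frob\<close>-image of the first one, and sums of six equal terms, which vanish in
  characteristic 2.\<close>

lemma blocks_affine:
  assumes "A \<in> blocks" and "a \<noteq> 0"
  shows "(\<lambda>x. a * x + b) ` A \<in> blocks"
proof -
  have A: "card A = 6" "(\<Sum>x\<in>A. x) = 0" "(\<Sum>x\<in>A. x * frob x) = 0"
    using assms(1) by (auto simp: blocks_def)
  have inj: "inj_on (\<lambda>x. a * x + b) A"
    using assms(2) by (auto simp: inj_on_def)
  have six: "(\<Sum>x\<in>A. z) = 0" for z :: 'a
  proof -
    have "(6::'a) = 2 * 3"
      by simp
    then show ?thesis
      by (simp only: sum_constant A(1) of_nat_numeral two_eq_zero mult_zero_left)
  qed
  have frob: "(\<Sum>x\<in>A. frob x) = 0"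
    using A(2) by (simp flip: frob_sum)
  have "(\<Sum>x\<in>A. a * x + b) = a * (\<Sum>x\<in>A. x) + (\<Sum>x\<in>A. b)"
    by (simp only: sum.distrib sum_distrib_left)
  then have "(\<Sum>x\<in>A. a * x + b) = 0"
    by (simp only: A six mult_zero_right add_0_right)
  moreover have "(\<Sum>x\<in>A. (a * x + b) * frob (a * x + b)) = a * frob a * (\<Sum>x\<in>A. x * frob x)
      + a * frob b * (\<Sum>x\<in>A. x) + b * frob a * (\<Sum>x\<in>A. frob x) + (\<Sum>x\<in>A. b * frob b)"
    unfolding sum_distrib_left sum.distrib[symmetric]
    by (rule sum.cong) (simp_all add: algebra_simps)
  then have "(\<Sum>x\<in>A. (a * x + b) * frob (a * x + b)) = 0"
    by (simp only: A frob six mult_zero_right add_0_right)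
  ultimately show ?thesis
    using A(1) inj by (simp add: blocks_def card_image sum.reindex)
qed

text \<open>An affine bijection taking \<open>x\<close> to \<open>x'\<close> and \<open>y\<close> to
  \<open>y'\<close> maps blocks to blocks injectively. Exchanging the two pairs turns the inequality
  into an equality.\<close>

lemma card_blocks_through_pair_le:
  assumes "x \<noteq> y" and "x' \<noteq> y'"
  shows "card {A \<in> blocks. {x, y} \<subseteq> A} \<le> card {A \<in> blocks. {x', y'} \<subseteq> A}"
proof -
  \<comment> \<open>Slope and offset of the line through the two prescribed values, with sums in
    place of differences.\<close>
  define a where "a = (y' + x') / (y + x)"
  define f where "f = (\<lambda>z. a * z + (x' + a * x))"
  have nz: "y + x \<noteq> 0" "a \<noteq> 0"
    using assms by (auto simp: a_def add_eq_zero_iff)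
  have "f x = x'"
    by (simp add: f_def char2_simps)
  moreover have "f y = a * (y + x) + x'"
    by (simp add: f_def char2_simps)
  then have "f y = y'"
    using nz(1) by (simp add: a_def add.assoc add_self)
  moreover have "inj f"
    using nz(2) by (auto simp: f_def inj_def)
  moreover have "f ` A \<in> blocks" if "A \<in> blocks" for A
    using blocks_affine[OF that nz(2)] by (simp add: f_def)
  ultimately show ?thesis
    by (intro card_inj_on_le[where f = "image f"]) (auto simp: inj_on_def inj_image_eq_iff)
qed

text \<open>The four further points of a block can be listed in 4! = 24 orders, and these lists are
  exactly the quadruples of \<open>T\<close> without coincidence.\<close>

lemma card_blocks_through_0_1:
  "24 * card {A \<in> blocks. {0, 1} \<subseteq> A} = (CARD('a))\<^sup>2 + 8 * CARD('a) + 96"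
proof -
  let ?F = "{A \<in> blocks. {0, 1} \<subseteq> A}"
  let ?D = "{(a, b, c, d) \<in> T. distinct [0, 1, a, b, c, d]}"
  let ?L = "\<Union>A\<in>?F. permutations_of_set (A - {0, 1})"
  let ?f = "\<lambda>(a, b, c, d). [a, b, c, d] :: 'a list"
  have block_iff: "{0, 1, a, b, c, d} \<in> blocks \<longleftrightarrow> (a, b, c, d) \<in> T"
    if "distinct [0, 1, a, b, c, d]" for a b c d :: 'a
  proof -
    have "1 + x = 0 \<longleftrightarrow> x = 1" for x :: 'a
      by (auto simp: add_eq_zero_iff)
    then show ?thesis
      using that by (simp add: blocks_def T_def add.assoc)
  qed
  have "?f ` ?D = ?L"
  proof (intro equalityI subsetI)
    fix xs assume "xs \<in> ?f ` ?D"
    then obtain a b c d where xs: "xs = [a, b, c, d]"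
      and T: "(a, b, c, d) \<in> T" and dist: "distinct [0, 1, a, b, c, d]"
      by auto
    have "{0, 1, a, b, c, d} \<in> ?F"
      using T dist block_iff by auto
    moreover have "xs \<in> permutations_of_set ({0, 1, a, b, c, d} - {0, 1})"
      using dist by (auto simp: permutations_of_set_def xs)
    ultimately show "xs \<in> ?L"
      by blast
  next
    fix xs assume "xs \<in> ?L"
    then obtain A where A: "A \<in> blocks" "0 \<in> A" "1 \<in> A"
      and xs: "set xs = A - {0, 1}" "distinct xs"
      by (auto simp: permutations_of_set_def)
    have "card (A - {0, 1}) = 4"
      using A by (subst card_Diff_subset) (auto simp: blocks_def)
    then have "length xs = 4"
      using xs distinct_card[of xs] by simp
    then obtain a b c d where abcd: "xs = [a, b, c, d]"
      by (auto simp: numeral_eq_Suc length_Suc_conv)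
    have "A = {0, 1, a, b, c, d}"
      using A xs(1) by (auto simp: abcd)
    moreover have "distinct [0, 1, a, b, c, d]"
      using xs by (auto simp: abcd)
    ultimately have "(a, b, c, d) \<in> ?D"
      using A(1) block_iff by auto
    then show "xs \<in> ?f ` ?D"
      unfolding abcd by (rule rev_image_eqI) simp
  qed
  moreover have "inj_on ?f ?D"
    by (auto simp: inj_on_def)
  ultimately have "card ?L = card ?D"
    by (metis (no_types, lifting) card_image)
  \<comment> \<open>A list determines its block by adjoining 0 and 1, so the union is
    disjoint.\<close>
  moreover have "card ?L = (\<Sum>A\<in>?F. card (permutations_of_set (A - {0, 1})))"
  proof (rule card_UN_disjoint)
    show "\<forall>A\<in>?F. \<forall>B\<in>?F. A \<noteq> B \<longrightarrow>
      permutations_of_set (A - {0, 1}) \<inter> permutations_of_set (B - {0, 1}) = {}"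
      by (auto simp: permutations_of_set_def)
  qed auto
  moreover have "card (permutations_of_set (A - {0, 1})) = 24" if "A \<in> ?F" for A
  proof -
    have "card (A - {0, 1}) = 4"
      using that by (subst card_Diff_subset) (auto simp: blocks_def)
    then show ?thesis
      by (simp add: fact_numeral)
  qed
  ultimately show ?thesis
    using card_T_distinct by simp
qed

text \<open>The bijection \<open>point\<close> carries the supports to \<open>blocks\<close>, where
  every pair lies in as many blocks as the pair 0, 1.\<close>

lemma design:
  "\<exists>l::nat. real l = (2 ^ (2 * m - 3) + 2 ^ m + 12) / 3 \<and>
    is_2_design (2 ^ m) 6 l {0..<2 ^ m}
      {support c | c. c \<in> extended_code
           (cyclic_code (2 ^ m - 1) (lcm (min_poly \<alpha>) (min_poly (\<alpha> ^ (1 + 2 ^ e)))))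
         \<and> hamming_weight c = 6}"
proof -
  define l where "l = card {A \<in> blocks. {0, 1} \<subseteq> A}"
  let ?B = "{support c | c. c \<in> extended_code
       (cyclic_code (2 ^ m - 1) (lcm (min_poly \<alpha>) (min_poly (\<alpha> ^ (1 + 2 ^ e)))))
     \<and> hamming_weight c = 6}"
  have inj: "inj_on point {0..<2 ^ m}" and surj: "point ` {0..<2 ^ m} = UNIV"
    using point_bij by (auto simp: bij_betw_def)
  have B: "S \<in> ?B \<longleftrightarrow> S \<subseteq> {0..<2 ^ m} \<and> point ` S \<in> blocks" for S
  proof (cases "S \<subseteq> {0..<2 ^ m}")
    case True
    then have "inj_on point S"
      using inj inj_on_subset by blast
    then show ?thesis
      using True supports_extended_code[of "1 + 2 ^ e" 6]
      by (simp add: blocks_def card_image sum.reindex frob_def N_def)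
  next
    case False
    then show ?thesis
      using supports_extended_code[of "1 + 2 ^ e" 6] by (simp add: N_def)
  qed
  have "card {S \<in> ?B. P \<subseteq> S} = l" if P: "P \<subseteq> {0..<2 ^ m}" "card P = 2" for P
  proof -
    obtain i j where ij: "P = {i, j}" "i \<noteq> j"
      using P(2) by (meson card_2_iff)
    then have ne: "point i \<noteq> point j"
      using inj P(1) by (auto simp: inj_on_def)
    let ?A = "{A \<in> blocks. {point i, point j} \<subseteq> A}"
    have sub: "{point i, point j} \<subseteq> point ` S \<longleftrightarrow> P \<subseteq> S" if "S \<subseteq> {0..<2 ^ m}" for S
      using that P(1) inj inj_on_image_mem_iff[OF inj _ that] by (simp add: ij)
    have "bij_betw (image point) {S \<in> ?B. P \<subseteq> S} ?A"
    proof (rule bij_betw_imageI)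
      show "inj_on (image point) {S \<in> ?B. P \<subseteq> S}"
        using inj B by (intro inj_on_subset[OF inj_on_image_Pow[OF inj]]) auto
      show "image point ` {S \<in> ?B. P \<subseteq> S} = ?A"
      proof (intro equalityI subsetI)
        fix A assume A: "A \<in> ?A"
        then obtain S where S: "S \<subseteq> {0..<2 ^ m}" "A = point ` S"
          using surj by (metis subset_UNIV subset_imageE)
        then have "S \<in> {S \<in> ?B. P \<subseteq> S}"
          using A B[of S] sub[of S] by blast
        then show "A \<in> image point ` {S \<in> ?B. P \<subseteq> S}"
          using S(2) by blast
      next
        fix A assume "A \<in> image point ` {S \<in> ?B. P \<subseteq> S}"
        then obtain S where S: "S \<in> ?B" "P \<subseteq> S" "A = point ` S"
          by blast
        then show "A \<in> ?A"
          using B[of S] sub[of S] by blast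
      qed
    qed
    then have "card {S \<in> ?B. P \<subseteq> S} = card ?A"
      by (rule bij_betw_same_card)
    also have "\<dots> = l"
      unfolding l_def using ne by (intro antisym card_blocks_through_pair_le) auto
    finally show ?thesis .
  qed
  moreover have "S \<subseteq> {0..<2 ^ m} \<and> card S = 6" if "S \<in> ?B" for S
    using that B[of S] by (auto simp: hamming_weight_def)
  ultimately have "is_2_design (2 ^ m) 6 l {0..<2 ^ m} ?B"
    unfolding is_2_design_def by simp
  moreover have "real l = (2 ^ (2 * m - 3) + 2 ^ m + 12) / 3"
  proof -
    \<comment> \<open>Exposes the factor 8 in the count for \<open>24 * l\<close>;
      \<open>m \<ge> 4\<close> keeps the exponent \<open>2 * m - 3\<close> from being
      truncated.\<close>
    have "(2::nat) ^ (2 * m) = 2 ^ (2 * m - 3) * 2 ^ 3"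
      using m_ge_4 by (simp only: power_add[symmetric]) simp
    then have "24 * l = 8 * 2 ^ (2 * m - 3) + 8 * 2 ^ m + 96"
      using card_blocks_through_0_1 by (simp add: l_def card_field mult.commute[of 2 m] flip: power_mult)
    then have "real (24 * l) = real (8 * 2 ^ (2 * m - 3) + 8 * 2 ^ m + 96)"
      by simp
    then show ?thesis
      by simp
  qed
  ultimately show ?thesis
    by blast
qed

end

theorem theorem3p9:
  fixes m e :: nat and \<alpha> :: "'a::{field,finite}"
  assumes "m > 0" and "m mod 4 = 0"
    and "2 \<le> e" and "e \<le> m div 2" and "gcd m e = 2"
    and "CARD('a) = 2 ^ m"
    and "generates_units \<alpha>"
  shows "\<exists>l::nat. real l = (2 ^ (2 * m - 3) + 2 ^ m + 12) / 3 \<and>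
    is_2_design (2 ^ m) 6 l {0..<2 ^ m}
      {support c | c. c \<in> extended_code
           (cyclic_code (2 ^ m - 1) (lcm (min_poly \<alpha>) (min_poly (\<alpha> ^ (1 + 2 ^ e)))))
         \<and> hamming_weight c = 6}"
proof -
  interpret gold_code m \<alpha> e
    using assms by unfold_locales auto
  show ?thesis
    by (rule design)
qed

end
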